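(* Let $\rho$ be a piecewise continuous probability measure on a measurable space $(E_X,\mathfrak B)$, with associated pairwise disjoint sets $E_1,\dots,E_k$ and $\sigma$-finite measures $\mu_1,\dots,\mu_k$, written in mixture form $\rho=\sum_{i=1}^kq_i\rho_i$ with $q_i=\rho(E_i)$ and $\rho_i=(\rho\llcorner E_i)/q_i$. Let $\mu=\sum_{i=1}^k\mu_i$. Then the equality $$H_\mu(\rho)=H_\#(q_1,\dots,q_k)+\sum_{i=1}^kq_iH_{\mu_i}(\rho_i)$$ holds, where $H_\#(q_1,\dots,q_k)=-\sum_{i=1}^kq_i\ln q_i$.
   Context: $\mu\llcorner A$ denotes the restricted measure $B\mapsto\mu(A\cap B)$. A measure $\rho$ on $(E_X,\mathfrak B)$ is piecewise continuous if for some integer $k\ge1$ there are pairwise disjoint sets $E_1,\dots,E_k\in\mathfrak B$ and $\sigma$-finite measures $\mu_1,\dots,\mu_k$ on $(E_X,\mathfrak B)$ such that (1) $\mu_i=\mu_i\llcorner E_i$; (2) $\rho(E_i)>0$ for all $i$; (3) $\rho(E_X\setminus\bigcup_{i=1}^kE_i)=0$; (4) $\rho\llcorner E_i\ll\mu_i$. For a $\sigma$-finite measure $\mu$ and a probability measure $\rho\ll\mu$ with density $f=d\rho/d\mu$, the generalized entropy is $H_\mu(\rho)=-\int f\ln f\,d\mu$ (convention $0\ln0=0$). *)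

theory Defs
  imports "HOL-Probability.Probability"
begin

definition restricted_measure :: "'a measure \<Rightarrow> 'a set \<Rightarrow> 'a measure" where
  "restricted_measure \<mu> A = measure_of (space \<mu>) (sets \<mu>) (\<lambda>B. emeasure \<mu> (A \<inter> B))"

lemma space_restricted_measure [simp]: "space (restricted_measure \<mu> A) = space \<mu>"
  by (simp add: restricted_measure_def)

lemma sets_restricted_measure [simp]: "sets (restricted_measure \<mu> A) = sets \<mu>"
  by (simp add: restricted_measure_def)

lemma emeasure_restricted_measure:
  assumes "A \<in> sets \<mu>" "B \<in> sets \<mu>"
  shows "emeasure (restricted_measure \<mu> A) B = emeasure \<mu> (A \<inter> B)"
proof -
  have "countably_additive (sets \<mu>) (\<lambda>B. emeasure \<mu> (A \<inter> B))"
  proof (rule countably_additiveI)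
    fix F :: "nat \<Rightarrow> 'a set"
    assume F: "range F \<subseteq> sets \<mu>" "disjoint_family F"
    have "(\<Sum>n. emeasure \<mu> (A \<inter> F n)) = emeasure \<mu> (\<Union>n. A \<inter> F n)"
    proof (rule suminf_emeasure)
      show "range (\<lambda>n. A \<inter> F n) \<subseteq> sets \<mu>" using F(1) assms(1) by auto
      show "disjoint_family (\<lambda>n. A \<inter> F n)"
        using F(2) by (auto simp: disjoint_family_on_def)
    qed
    then show "(\<Sum>n. emeasure \<mu> (A \<inter> F n)) = emeasure \<mu> (A \<inter> (\<Union>n. F n))"
      by simp
  qed
  then show ?thesis
    unfolding restricted_measure_def
    by (intro emeasure_measure_of_sigma[OF sets.sigma_algebra_axioms _ _ assms(2)])
      (simp_all add: positive_def)
qed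

text \<open>The argument \<open>M\<close> only supplies the measurable space on which the
  measures \<open>\<mu> i\<close> live.\<close>

definition sum_of_measures :: "'a measure \<Rightarrow> 'i set \<Rightarrow> ('i \<Rightarrow> 'a measure) \<Rightarrow> 'a measure" where
  "sum_of_measures M I \<mu> = measure_of (space M) (sets M) (\<lambda>B. \<Sum>i\<in>I. emeasure (\<mu> i) B)"

lemma space_sum_of_measures [simp]: "space (sum_of_measures M I \<mu>) = space M"
  by (simp add: sum_of_measures_def)

lemma sets_sum_of_measures [simp]: "sets (sum_of_measures M I \<mu>) = sets M"
  by (simp add: sum_of_measures_def)

lemma emeasure_sum_of_measures:
  fixes M :: "'a measure"
  assumes "\<And>i. i \<in> I \<Longrightarrow> sets (\<mu> i) = sets M" "B \<in> sets M"
  shows "emeasure (sum_of_measures M I \<mu>) B = (\<Sum>i\<in>I. emeasure (\<mu> i) B)"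
proof -
  have "countably_additive (sets M) (\<lambda>B. \<Sum>i\<in>I. emeasure (\<mu> i) B)"
  proof (rule countably_additiveI)
    fix F :: "nat \<Rightarrow> 'a set"
    assume F: "range F \<subseteq> sets M" "disjoint_family F"
    have "(\<Sum>n. \<Sum>i\<in>I. emeasure (\<mu> i) (F n)) = (\<Sum>i\<in>I. \<Sum>n. emeasure (\<mu> i) (F n))"
      by (rule suminf_sum) simp
    also have "\<dots> = (\<Sum>i\<in>I. emeasure (\<mu> i) (\<Union>n. F n))"
      using F by (intro sum.cong refl suminf_emeasure) (simp_all add: assms(1))
    finally show "(\<Sum>n. \<Sum>i\<in>I. emeasure (\<mu> i) (F n)) = (\<Sum>i\<in>I. emeasure (\<mu> i) (\<Union>n. F n))" .
  qed
  then show ?thesis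
    unfolding sum_of_measures_def
    by (intro emeasure_measure_of_sigma[OF sets.sigma_algebra_axioms _ _ assms(2)])
      (simp_all add: positive_def)
qed

definition piecewise_continuous_with ::
  "'a measure \<Rightarrow> nat \<Rightarrow> (nat \<Rightarrow> 'a set) \<Rightarrow> (nat \<Rightarrow> 'a measure) \<Rightarrow> bool" where
  "piecewise_continuous_with \<rho> k E \<mu> \<longleftrightarrow>
     1 \<le> k \<and>
     (\<forall>i\<in>{1..k}. E i \<in> sets \<rho>) \<and>
     disjoint_family_on E {1..k} \<and>
     (\<forall>i\<in>{1..k}. sets (\<mu> i) = sets \<rho> \<and> sigma_finite_measure (\<mu> i)) \<and>
     (\<forall>i\<in>{1..k}. \<mu> i = restricted_measure (\<mu> i) (E i)) \<and>
     (\<forall>i\<in>{1..k}. emeasure \<rho> (E i) > 0) \<and>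
     emeasure \<rho> (space \<rho> - (\<Union>i\<in>{1..k}. E i)) = 0 \<and>
     (\<forall>i\<in>{1..k}. absolutely_continuous (\<mu> i) (restricted_measure \<rho> (E i)))"

definition piecewise_continuous :: "'a measure \<Rightarrow> bool" where
  "piecewise_continuous \<rho> \<longleftrightarrow> (\<exists>k E \<mu>. piecewise_continuous_with \<rho> k E \<mu>)"

text \<open>The integral \<open>- \<integral> f ln f d\<mu>\<close> is taken with values in the extended reals:
  it is the integral of the negative part of \<open>f ln f\<close> minus that of the positive
  part. It is finite iff \<open>f ln f\<close> is integrable; if both parts have infinite integral
  (so that the integral is undefined) the value is \<open>\<infinity>\<close>, by the \<^typ>\<open>ereal\<close>
  convention \<open>\<infinity> - \<infinity> = \<infinity>\<close>. The convention \<open>0 ln 0 = 0\<close> is automatic.\<close>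

definition generalized_entropy :: "'a measure \<Rightarrow> 'a measure \<Rightarrow> ereal" where
  "generalized_entropy \<mu> \<rho> =
     (let f = (\<lambda>x. enn2real (RN_deriv \<mu> \<rho> x)) in
        enn2ereal (\<integral>\<^sup>+ x. ennreal (- (f x * ln (f x))) \<partial>\<mu>)
        - enn2ereal (\<integral>\<^sup>+ x. ennreal (f x * ln (f x)) \<partial>\<mu>))"

lemma generalized_entropy_eq_integral:
  fixes \<mu> \<rho> :: "'a measure"
  defines "f \<equiv> \<lambda>x. enn2real (RN_deriv \<mu> \<rho> x)"
  assumes int: "integrable \<mu> (\<lambda>x. f x * ln (f x))"
  shows "generalized_entropy \<mu> \<rho> = ereal (- (\<integral>x. f x * ln (f x) \<partial>\<mu>))"
proof -
  let ?g = "\<lambda>x. f x * ln (f x)"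
  let ?P = "\<integral>\<^sup>+ x. ennreal (?g x) \<partial>\<mu>" and ?N = "\<integral>\<^sup>+ x. ennreal (- ?g x) \<partial>\<mu>"
  have fin: "?P \<noteq> \<infinity>" "?N \<noteq> \<infinity>"
    using int by (auto simp: real_integrable_def)
  obtain p where p: "?P = ennreal p" "0 \<le> p" using fin(1) by (cases ?P) auto
  obtain n where n: "?N = ennreal n" "0 \<le> n" using fin(2) by (cases ?N) auto
  have "(\<integral>x. ?g x \<partial>\<mu>) = p - n"
    using real_lebesgue_integral_def[OF int] p n by simp
  moreover have "generalized_entropy \<mu> \<rho> = enn2ereal ?N - enn2ereal ?P"
    by (simp add: generalized_entropy_def f_def Let_def)
  ultimately show ?thesis using p n by simp
qed

definition shannon_entropy :: "nat \<Rightarrow> (nat \<Rightarrow> real) \<Rightarrow> real" where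
  "shannon_entropy k q = - (\<Sum>i=1..k. q i * ln (q i))"

end

theory Submission
  imports Defs
begin

text \<open>Let \<open>D\<close> be a density of \<open>\<rho>\<close> with respect to \<open>\<mu>\<close>. Since \<open>\<mu> j\<close> is concentrated on
  \<open>E j\<close>, the function \<open>D\<close> is also a density of the restriction of \<open>\<rho>\<close> to \<open>E i\<close> with respect
  to \<open>\<mu> i\<close>, so \<open>D / q i\<close> is a density of \<open>\<rho>' i\<close>. Integrating
  \<open>- D ln D = q i * (- (D / q i) ln (D / q i)) - ln (q i) * D\<close> against \<open>\<mu> i\<close> and summing over
  \<open>i\<close> gives the identity. It survives infinite values because \<open>\<infinity> - \<infinity> = \<infinity> + (-\<infinity>) = \<infinity>\<close> in
  \<^typ>\<open>ereal\<close>: either side is \<open>\<infinity>\<close> exactly when the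
  positive part of \<open>- D ln D\<close> has infinite integral over some \<open>\<mu> i\<close>.\<close>

section \<open>Extended-real integrals\<close>

text \<open>Keeping the two parts separate lets infinite values through: for
  \<open>h = - f ln f\<close>, with \<open>f\<close> the Radon-Nikodym density, this is exactly
  \<open>generalized_entropy\<close>. If both parts are infinite, the value is \<infinity>.\<close>

definition ereal_integral :: "'a measure \<Rightarrow> ('a \<Rightarrow> real) \<Rightarrow> ereal" where
  "ereal_integral M h =
     enn2ereal (\<integral>\<^sup>+x. ennreal (h x) \<partial>M) - enn2ereal (\<integral>\<^sup>+x. ennreal (- h x) \<partial>M)"

lemma ereal_integral_cong_AE:
  assumes "AE x in M. g x = h x"
  shows "ereal_integral M g = ereal_integral M h"
proof -
  have "(\<integral>\<^sup>+x. ennreal (g x) \<partial>M) = (\<integral>\<^sup>+x. ennreal (h x) \<partial>M)"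
    "(\<integral>\<^sup>+x. ennreal (- g x) \<partial>M) = (\<integral>\<^sup>+x. ennreal (- h x) \<partial>M)"
    using assms by (auto intro!: nn_integral_cong_AE)
  then show ?thesis by (simp add: ereal_integral_def)
qed

text \<open>Both parts scale by \<open>c\<close>, and a positive real factor distributes over the
  difference even for \<infinity> - \<infinity>, where both sides are \<infinity>.\<close>

lemma ereal_integral_cmult:
  assumes [measurable]: "h \<in> borel_measurable M" and c: "0 < c"
  shows "ereal_integral M (\<lambda>x. c * h x) = ereal c * ereal_integral M h"
proof -
  have "ennreal (c * y) = ennreal c * ennreal y" "ennreal (- (c * y)) = ennreal c * ennreal (- y)"
    for y using c ennreal_mult'[of c y] ennreal_mult'[of c "- y"] by simp_all
  then have "(\<integral>\<^sup>+x. ennreal (c * h x) \<partial>M) = ennreal c * (\<integral>\<^sup>+x. ennreal (h x) \<partial>M)"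
    "(\<integral>\<^sup>+x. ennreal (- (c * h x)) \<partial>M) = ennreal c * (\<integral>\<^sup>+x. ennreal (- h x) \<partial>M)"
    by (simp_all add: nn_integral_cmult)
  moreover have "ereal c * (a - b) = ereal c * a - ereal c * b" for a b
    using c by (cases a; cases b) (simp_all add: right_diff_distrib)
  ultimately show ?thesis
    using c by (simp add: ereal_integral_def times_ennreal.rep_eq)
qed

text \<open>Positive parts are only subadditive, so the parts of \<open>h + g\<close> do not split
  termwise. Instead, a balance identity between all the parts is integrated, and finite terms are
  cancelled.\<close>

lemma ereal_integral_add_integrable:
  assumes [measurable]: "h \<in> borel_measurable M" and g: "integrable M g"
  shows "ereal_integral M (\<lambda>x. h x + g x) = ereal_integral M h + ereal (\<integral>x. g x \<partial>M)"
proof -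
  define P N P' N' where "P = (\<integral>\<^sup>+x. ennreal (h x) \<partial>M)" and "N = (\<integral>\<^sup>+x. ennreal (- h x) \<partial>M)"
    and "P' = (\<integral>\<^sup>+x. ennreal (h x + g x) \<partial>M)" and "N' = (\<integral>\<^sup>+x. ennreal (- (h x + g x)) \<partial>M)"
  let ?p = "\<integral>\<^sup>+x. ennreal (g x) \<partial>M" and ?n = "\<integral>\<^sup>+x. ennreal (- g x) \<partial>M"
  have [measurable]: "g \<in> borel_measurable M" using g by simp
  have "?p \<noteq> \<infinity>" "?n \<noteq> \<infinity>" using g by (auto simp: real_integrable_def)
  then obtain p n where p: "?p = ennreal p" "0 \<le> p" and n: "?n = ennreal n" "0 \<le> n"
    by (metis ennreal_cases infinity_ennreal_def)
  have int: "(\<integral>x. g x \<partial>M) = p - n"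
    using real_lebesgue_integral_def[OF g] p n by simp
  \<comment> \<open>Here \<open>a\<close>, \<open>b\<close> and \<open>a + b\<close> are decomposed
    into positive and negative parts, and the negative parts are moved across so that no subtraction
    occurs in \<open>ennreal\<close>.\<close>
  have balance: "ennreal (a + b) + ennreal (- a) + ennreal (- b)
      = ennreal (- (a + b)) + ennreal a + ennreal b" for a b :: real
    by (auto simp: ennreal_plus_if ennreal_neg)
  have subadd: "ennreal (a + b) \<le> ennreal a + ennreal b" for a b :: real
    by (simp add: ennreal_plus_if ennreal_leI)
  have "P' + N + ?n = N' + P + ?p"
    unfolding P_def N_def P'_def N'_def
    by (simp add: balance flip: nn_integral_add)
  moreover have "P' \<le> P + ?p"
    unfolding P_def P'_def by (simp add: subadd nn_integral_mono flip: nn_integral_add)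
  moreover have "P \<le> P' + ?n"
    unfolding P_def P'_def
    using subadd[of "h x + g x" "- g x" for x]
    by (auto simp flip: nn_integral_add intro!: nn_integral_mono)
  moreover have "N' \<le> N + ?n"
    unfolding N_def N'_def
    using subadd[of "- h x" "- g x" for x]
    by (auto simp flip: nn_integral_add intro!: nn_integral_mono)
  moreover have "N \<le> N' + ?p"
    unfolding N_def N'_def
    using subadd[of "- (h x + g x)" "g x" for x]
    by (auto simp flip: nn_integral_add intro!: nn_integral_mono)
  ultimately have le: "P' + N + ?n = N' + P + ?p" "P' \<le> P + ?p" "P \<le> P' + ?n"
    "N' \<le> N + ?n" "N \<le> N' + ?p" .
  \<comment> \<open>Both parts of \<open>g\<close> have finite integral, so the four bounds show
    that adding \<open>g\<close> does not change whether the positive or the negative part is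
    infinite.\<close>
  have top: "P' = top \<longleftrightarrow> P = top" "N' = top \<longleftrightarrow> N = top"
    using le(2-) p n by (auto simp: top_unique)
  have "enn2ereal P' - enn2ereal N' = enn2ereal P - enn2ereal N + ereal (p - n)"
  \<comment> \<open>With an infinite part, both sides have the same infinite value. Otherwise the
    balance equation can be read in the reals and rearranged.\<close>
  proof (cases "P = top \<or> N = top")
    case True
    then show ?thesis using top by (cases P; cases N; cases P'; cases N') auto
  next
    case False
    then obtain a b a' b' where ab: "P = ennreal a" "N = ennreal b" "P' = ennreal a'" "N' = ennreal b'"
      "0 \<le> a" "0 \<le> b" "0 \<le> a'" "0 \<le> b'"
      using top by (metis ennreal_cases)
    then have "ennreal (a' + b + n) = ennreal (b' + a + p)"
      using le(1) p n by simp
    then have "a' + b + n = b' + a + p"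
      using ab p n by (subst (asm) ennreal_inj) auto
    then show ?thesis using ab by simp
  qed
  then show ?thesis
    by (simp add: ereal_integral_def int P_def N_def P'_def N'_def)
qed

section \<open>Finite sums of measures\<close>

lemma measurable_sum_of_measures [simp]:
  "measurable (sum_of_measures M I \<mu>) N = measurable M N"
  by (rule measurable_cong_sets) simp_all

text \<open>Nonnegative measurable functions are built up from indicators. The limit step exchanges
  the supremum with the sum over \<open>I\<close>, which holds because the integrals increase with
  \<open>n\<close>.\<close>

lemma nn_integral_sum_of_measures:
  fixes M :: "'a measure"
  assumes sets: "\<And>i. i \<in> I \<Longrightarrow> sets (\<mu> i) = sets M" and u: "u \<in> borel_measurable M"
  shows "(\<integral>\<^sup>+x. u x \<partial>sum_of_measures M I \<mu>) = (\<Sum>i\<in>I. \<integral>\<^sup>+x. u x \<partial>\<mu> i)"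
proof -
  have meas: "v \<in> borel_measurable (\<mu> i) \<longleftrightarrow> v \<in> borel_measurable M"
    if "i \<in> I" for v :: "'a \<Rightarrow> ennreal" and i
    using measurable_cong_sets[OF sets[OF that] refl] by blast
  have sp: "space (\<mu> i) = space M" if "i \<in> I" for i
    using sets[OF that] by (rule sets_eq_imp_space_eq)
  show ?thesis
    using u
  proof (induct rule: borel_measurable_induct)
    case (cong f g)
    have "(\<integral>\<^sup>+x. f x \<partial>sum_of_measures M I \<mu>) = (\<integral>\<^sup>+x. g x \<partial>sum_of_measures M I \<mu>)"
      using cong by (intro nn_integral_cong) simp
    moreover have "(\<integral>\<^sup>+x. f x \<partial>\<mu> i) = (\<integral>\<^sup>+x. g x \<partial>\<mu> i)" if "i \<in> I" for i
      using cong sp[OF that] by (intro nn_integral_cong) simp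
    ultimately show ?case using cong by simp
  next
    case (set A)
    then show ?case using sets by (simp add: emeasure_sum_of_measures)
  next
    case (mult u c)
    then show ?case by (simp add: nn_integral_cmult meas sum_distrib_left)
  next
    case (add u v)
    then show ?case by (simp add: nn_integral_add meas sum.distrib)
  next
    case (seq U)
    have SUP: "(\<integral>\<^sup>+x. (SUP n. U n) x \<partial>N) = (SUP n. \<integral>\<^sup>+x. U n x \<partial>N)"
      if "\<And>n. U n \<in> borel_measurable N" for N
      using nn_integral_monotone_convergence_SUP[OF \<open>incseq U\<close> that] by (simp add: image_comp)
    have mono: "incseq (\<lambda>n. \<integral>\<^sup>+x. U n x \<partial>\<mu> i)" for i
      using \<open>incseq U\<close> by (auto simp: incseq_def le_fun_def intro!: nn_integral_mono)
    have "(\<integral>\<^sup>+x. (SUP n. U n) x \<partial>sum_of_measures M I \<mu>)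
        = (SUP n. \<Sum>i\<in>I. \<integral>\<^sup>+x. U n x \<partial>\<mu> i)"
      using seq by (subst SUP) simp_all
    also have "\<dots> = (\<Sum>i\<in>I. SUP n. \<integral>\<^sup>+x. U n x \<partial>\<mu> i)"
      using mono by (intro ennreal_SUP_sum) auto
    also have "\<dots> = (\<Sum>i\<in>I. \<integral>\<^sup>+x. (SUP n. U n) x \<partial>\<mu> i)"
      using seq(1) by (intro sum.cong refl SUP[symmetric]) (simp add: meas)
    finally show ?case .
  qed
qed

text \<open>Increasing exhaustions by sets of finite measure, one for each \<open>\<mu> i\<close>,
  are intersected index by index. Since \<open>I\<close> is finite, the intersections still exhaust
  the space.\<close>

lemma sigma_finite_sum_of_measures:
  fixes M :: "'a measure"
  assumes "finite I" and sets: "\<And>i. i \<in> I \<Longrightarrow> sets (\<mu> i) = sets M"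
    and sf: "\<And>i. i \<in> I \<Longrightarrow> sigma_finite_measure (\<mu> i)"
  shows "sigma_finite_measure (sum_of_measures M I \<mu>)"
proof -
  have "\<exists>A :: nat \<Rightarrow> 'a set. range A \<subseteq> sets M \<and> (\<Union>n. A n) = space M
      \<and> (\<forall>n. emeasure (\<mu> i) (A n) \<noteq> \<infinity>) \<and> incseq A" if "i \<in> I" for i
    using sigma_finite_measure.sigma_finite_incseq[OF sf[OF that]]
      sets[OF that] sets_eq_imp_space_eq[OF sets[OF that]] by metis
  then obtain A :: "_ \<Rightarrow> nat \<Rightarrow> 'a set" where
    A: "\<And>i. i \<in> I \<Longrightarrow> range (A i) \<subseteq> sets M" "\<And>i. i \<in> I \<Longrightarrow> (\<Union>n. A i n) = space M"
    "\<And>i n. i \<in> I \<Longrightarrow> emeasure (\<mu> i) (A i n) \<noteq> \<infinity>" "\<And>i. i \<in> I \<Longrightarrow> incseq (A i)"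
    by metis
  \<comment> \<open>The factor \<open>space M\<close> keeps \<open>B n\<close> inside the space when
    \<open>I\<close> is empty and the inner intersection is \<open>UNIV\<close>.\<close>
  define B where "B n = space M \<inter> (\<Inter>i\<in>I. A i n)" for n
  have B: "B n \<in> sets M" for n
    using A(1) \<open>finite I\<close> by (cases "I = {}") (auto simp: B_def intro!: sets.Int sets.finite_INT)
  have fin: "emeasure (sum_of_measures M I \<mu>) (B n) \<noteq> \<infinity>" for n
  proof -
    have "emeasure (\<mu> i) (B n) < top" if "i \<in> I" for i
    proof -
      have "emeasure (\<mu> i) (B n) \<le> emeasure (\<mu> i) (A i n)"
        using that A(1)[OF that] sets[OF that] by (intro emeasure_mono) (auto simp: B_def)
      then show ?thesis using A(3)[OF that, of n] by (auto simp: less_top top_unique)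
    qed
    then show ?thesis
      using emeasure_sum_of_measures[of I \<mu> M "B n", OF sets B] \<open>finite I\<close>
      by (simp flip: less_top)
  qed
  have "x \<in> (\<Union>n. B n)" if x: "x \<in> space M" for x
  proof -
    have "\<exists>n. x \<in> A i n" if "i \<in> I" for i using A(2)[OF that] x by blast
    then obtain n where n: "\<And>i. i \<in> I \<Longrightarrow> x \<in> A i (n i)" by metis
    \<comment> \<open>The sum of the thresholds \<open>n j\<close> dominates each of them, so it is
      one index that serves every \<open>i\<close>.\<close>
    have "x \<in> A i (\<Sum>j\<in>I. n j)" if "i \<in> I" for i
      using n[OF that] incseqD[OF A(4)[OF that], of "n i" "\<Sum>j\<in>I. n j"]
        member_le_sum[OF that, of n] \<open>finite I\<close> by auto
    then show ?thesis using x by (auto simp: B_def)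
  qed
  then have "(\<Union>n. B n) = space M" by (auto simp: B_def)
  then show ?thesis
    using B fin by (intro sigma_finite_measure.intro exI[of _ "range B"]) auto
qed

lemma ereal_integral_sum_of_measures:
  assumes "finite I" and sets: "\<And>i. i \<in> I \<Longrightarrow> sets (\<mu> i) = sets M"
    and [measurable]: "h \<in> borel_measurable M"
  shows "ereal_integral (sum_of_measures M I \<mu>) h = (\<Sum>i\<in>I. ereal_integral (\<mu> i) h)"
proof -
  have diff_sum: "enn2ereal (\<Sum>i\<in>I. a i) - enn2ereal (\<Sum>i\<in>I. b i)
      = (\<Sum>i\<in>I. enn2ereal (a i) - enn2ereal (b i))" for a b :: "_ \<Rightarrow> ennreal"
    using \<open>finite I\<close>
  proof induct
    case empty
    show ?case by (simp add: zero_ennreal.rep_eq)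
  next
    case (insert i I)
    \<comment> \<open>No finiteness is required: an infinite \<open>a1\<close> or \<open>a2\<close>
      makes both sides \<infinity>, because \<infinity> absorbs -\<infinity> in \<open>ereal\<close>
      addition.\<close>
    have "enn2ereal (a1 + a2) - enn2ereal (b1 + b2)
        = (enn2ereal a1 - enn2ereal b1) + (enn2ereal a2 - enn2ereal b2)" for a1 a2 b1 b2
      by (cases a1; cases a2; cases b1; cases b2)
        (simp_all add: top_add add_top flip: ennreal_plus)
    then show ?case using insert by simp
  qed
  show ?thesis
    by (simp add: ereal_integral_def nn_integral_sum_of_measures[OF sets] diff_sum)
qed

section \<open>Entropy of piecewise continuous measures\<close>

text \<open>Densities with respect to a sigma-finite measure are unique almost everywhere, so any
  nonnegative real version may replace \<open>RN_deriv\<close>.\<close>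

lemma generalized_entropy_density:
  fixes D :: "'a \<Rightarrow> real"
  assumes "sigma_finite_measure M" and [measurable]: "D \<in> borel_measurable M"
    and "\<And>x. 0 \<le> D x" and N: "density M (\<lambda>x. ennreal (D x)) = N"
  shows "generalized_entropy M N = ereal_integral M (\<lambda>x. - (D x * ln (D x)))"
proof -
  let ?f = "\<lambda>x. enn2real (RN_deriv M N x)"
  have "AE x in M. ennreal (D x) = RN_deriv M N x"
    using N by (intro sigma_finite_measure.RN_deriv_unique[OF assms(1)]) simp_all
  then have "AE x in M. - (?f x * ln (?f x)) = - (D x * ln (D x))"
    by eventually_elim (metis assms(3) enn2real_ennreal)
  moreover have "generalized_entropy M N = ereal_integral M (\<lambda>x. - (?f x * ln (?f x)))"
    by (simp add: generalized_entropy_def ereal_integral_def)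
  ultimately show ?thesis by (simp add: ereal_integral_cong_AE)
qed

text \<open>For \<open>d > 0\<close> this is \<open>ln d = ln (d / q) + ln q\<close>; at
  \<open>d = 0\<close> every term vanishes. The term linear in \<open>d\<close> is the source of the
  Shannon entropy.\<close>

lemma entropy_integrand_rescale:
  fixes q d :: real
  assumes "0 < q" "0 \<le> d"
  shows "- (d * ln d) = q * - (d / q * ln (d / q)) + - ln q * d"
  using assms by (cases "d = 0") (simp_all add: ln_div right_diff_distrib)

text \<open>A null set of the sum is null for each \<open>\<mu> i\<close>, hence meets each
  \<open>E i\<close> in a \<rho>-null set; what lies outside all \<open>E i\<close> is \<rho>-null
  as well.\<close>

lemma piecewise_absolutely_continuous:
  assumes pc: "piecewise_continuous_with \<rho> k E \<mu>"
  shows "absolutely_continuous (sum_of_measures \<rho> {1..k} \<mu>) \<rho>"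
proof -
  note pc = pc[unfolded piecewise_continuous_with_def]
  have "B \<in> null_sets \<rho>" if B: "B \<in> null_sets (sum_of_measures \<rho> {1..k} \<mu>)" for B
  proof -
    have Bm: "B \<in> sets \<rho>" using null_setsD2[OF B] by simp
    have "(\<Sum>i=1..k. emeasure (\<mu> i) B) = 0"
      using null_setsD1[OF B] emeasure_sum_of_measures[of "{1..k}" \<mu> \<rho> B] pc Bm by auto
    then have zero: "emeasure (\<mu> i) B = 0" if "i \<in> {1..k}" for i
      using that by simp
    have "E i \<inter> B \<in> null_sets \<rho>" if i: "i \<in> {1..k}" for i
    proof -
      have "B \<in> null_sets (\<mu> i)" using zero[OF i] pc i Bm by auto
      then have "B \<in> null_sets (restricted_measure \<rho> (E i))"
        using pc i by (auto simp: absolutely_continuous_def)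
      then show ?thesis
        using emeasure_restricted_measure[of "E i" \<rho> B] pc i Bm by (auto simp: null_sets_def)
    qed
    then have "(\<Union>i\<in>{1..k}. E i \<inter> B) \<union> (space \<rho> - (\<Union>i\<in>{1..k}. E i)) \<in> null_sets \<rho>"
      using pc by (intro null_sets.Un null_sets_UN') (auto simp: null_sets_def)
    then show ?thesis
      by (rule null_sets_subset) (use Bm sets.sets_into_space[OF Bm] in auto)
  qed
  then show ?thesis by (auto simp: absolutely_continuous_def)
qed

text \<open>Integrating \<open>D\<close> over \<open>E i \<inter> B\<close> against the sum gives
  the \<rho>-measure of that set, and only the summand of \<open>\<mu> i\<close> survives.\<close>

lemma piecewise_density:
  assumes pc: "piecewise_continuous_with \<rho> k E \<mu>"
    and D: "D \<in> borel_measurable \<rho>" "density (sum_of_measures \<rho> {1..k} \<mu>) D = \<rho>"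
    and i: "i \<in> {1..k}"
  shows "density (\<mu> i) D = restricted_measure \<rho> (E i)"
proof (rule measure_eqI)
  note pc = pc[unfolded piecewise_continuous_with_def]
  let ?M = "sum_of_measures \<rho> {1..k} \<mu>"
  have sets: "sets (\<mu> j) = sets \<rho>" if "j \<in> {1..k}" for j using pc that by auto
  have [measurable]: "E j \<in> sets \<rho>" if "j \<in> {1..k}" for j using pc that by auto
  note [measurable] = D(1)
  show "sets (density (\<mu> i) D) = sets (restricted_measure \<rho> (E i))"
    using sets[OF i] by simp
  fix B assume "B \<in> sets (density (\<mu> i) D)"
  then have B[measurable]: "B \<in> sets \<rho>" using sets[OF i] by simp
  have Dm: "D \<in> borel_measurable (\<mu> j)" if "j \<in> {1..k}" for j
    using measurable_cong_sets[OF sets[OF that] refl] D(1) by blast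
  \<comment> \<open>\<open>\<mu> j\<close> equals its own restriction to \<open>E j\<close>, so it
    gives the complement of \<open>E j\<close> measure zero.\<close>
  have AE_E: "AE x in \<mu> j. x \<in> E j" if j: "j \<in> {1..k}" for j
  proof (rule AE_I)
    let ?C = "space \<rho> - E j"
    have sp: "space (\<mu> j) = space \<rho>" using sets[OF j] by (rule sets_eq_imp_space_eq)
    show "{x \<in> space (\<mu> j). x \<notin> E j} \<subseteq> ?C" using sp by auto
    show "?C \<in> sets (\<mu> j)" using sets[OF j] j by simp
    have "emeasure (\<mu> j) ?C = emeasure (restricted_measure (\<mu> j) (E j)) ?C"
      using pc j by metis
    also have "\<dots> = emeasure (\<mu> j) (E j \<inter> ?C)"
      using sets[OF j] j by (intro emeasure_restricted_measure) simp_all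
    finally show "emeasure (\<mu> j) ?C = 0" by simp
  qed
  have piece: "(\<integral>\<^sup>+x. D x * indicator (E i \<inter> B) x \<partial>\<mu> j)
      = (if j = i then emeasure (density (\<mu> i) D) B else 0)" if j: "j \<in> {1..k}" for j
  proof (cases "j = i")
    case True
    have "(\<integral>\<^sup>+x. D x * indicator (E i \<inter> B) x \<partial>\<mu> i) = (\<integral>\<^sup>+x. D x * indicator B x \<partial>\<mu> i)"
      using AE_E[OF i] by (intro nn_integral_cong_AE) (auto split: split_indicator)
    then show ?thesis using True sets[OF i] by (simp add: emeasure_density Dm[OF i])
  next
    case False
    then have "E i \<inter> E j = {}"
      using pc i j by (auto simp: disjoint_family_on_def)
    then have "AE x in \<mu> j. D x * indicator (E i \<inter> B) x = 0"
      using AE_E[OF j] by (auto split: split_indicator)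
    then have "(\<integral>\<^sup>+x. D x * indicator (E i \<inter> B) x \<partial>\<mu> j) = (\<integral>\<^sup>+x. 0 \<partial>\<mu> j)"
      by (rule nn_integral_cong_AE)
    then show ?thesis using False by simp
  qed
  have "emeasure (restricted_measure \<rho> (E i)) B = emeasure (density ?M D) (E i \<inter> B)"
    using i D(2) by (simp add: emeasure_restricted_measure)
  also have "\<dots> = (\<integral>\<^sup>+x. D x * indicator (E i \<inter> B) x \<partial>?M)"
    using i D(1) by (intro emeasure_density) auto
  also have "\<dots> = (\<Sum>j=1..k. \<integral>\<^sup>+x. D x * indicator (E i \<inter> B) x \<partial>\<mu> j)"
    using i sets by (intro nn_integral_sum_of_measures) auto
  also have "\<dots> = emeasure (density (\<mu> i) D) B"
    using i by (simp add: piece)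
  finally show "emeasure (density (\<mu> i) D) B = emeasure (restricted_measure \<rho> (E i)) B" ..
qed

theorem lemma4:
  fixes \<rho> :: "'a measure" and k :: nat
    and E :: "nat \<Rightarrow> 'a set" and \<mu> :: "nat \<Rightarrow> 'a measure"
    and q :: "nat \<Rightarrow> real" and \<rho>' :: "nat \<Rightarrow> 'a measure"
  assumes "prob_space \<rho>"
    and "piecewise_continuous_with \<rho> k E \<mu>"
    and "\<And>i. i \<in> {1..k} \<Longrightarrow> q i = measure \<rho> (E i)"
    and "\<And>i. i \<in> {1..k} \<Longrightarrow>
           \<rho>' i = scale_measure (ennreal (1 / q i)) (restricted_measure \<rho> (E i))"
  shows "generalized_entropy (sum_of_measures \<rho> {1..k} \<mu>) \<rho> =
           ereal (shannon_entropy k q)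
           + (\<Sum>i=1..k. ereal (q i) * generalized_entropy (\<mu> i) (\<rho>' i))"
proof -
  interpret prob_space \<rho> by fact
  note pc = assms(2)[unfolded piecewise_continuous_with_def]
  let ?M = "sum_of_measures \<rho> {1..k} \<mu>"
  have sets: "sets (\<mu> i) = sets \<rho>" and sf: "sigma_finite_measure (\<mu> i)"
    and E: "E i \<in> sets \<rho>" if "i \<in> {1..k}" for i
    using pc that by auto
  have sfM: "sigma_finite_measure ?M"
    by (rule sigma_finite_sum_of_measures) (use sets sf in auto)
  \<comment> \<open>Finiteness of \<rho> provides a version of the density that is real-valued and
    nonnegative everywhere.\<close>
  obtain D where D: "D \<in> borel_measurable ?M" "\<And>x. 0 \<le> D x"
    "AE x in ?M. RN_deriv ?M \<rho> x = ennreal (D x)"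
    using sigma_finite_measure.real_RN_deriv[OF sfM finite_measure_axioms
        piecewise_absolutely_continuous[OF assms(2)]] by (metis sets_sum_of_measures)
  have dens: "density ?M (\<lambda>x. ennreal (D x)) = \<rho>"
    using sigma_finite_measure.density_RN_deriv[OF sfM
        piecewise_absolutely_continuous[OF assms(2)]]
      density_cong[OF borel_measurable_RN_deriv _ D(3)] D(1) by simp
  have Dm[measurable]: "D \<in> borel_measurable \<rho>"
    using D(1) by simp
  have piece: "ereal_integral (\<mu> i) (\<lambda>x. - (D x * ln (D x)))
      = ereal (q i) * generalized_entropy (\<mu> i) (\<rho>' i) + ereal (- (q i * ln (q i)))"
    if i: "i \<in> {1..k}" for i
  proof -
    have q: "0 < q i"
      using pc i assms(3)[OF i] by (auto simp: emeasure_eq_measure)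
    have Dmi[measurable]: "D \<in> borel_measurable (\<mu> i)"
      using measurable_cong_sets[OF sets[OF i] refl] Dm by blast
    have restr: "density (\<mu> i) (\<lambda>x. ennreal (D x)) = restricted_measure \<rho> (E i)"
      using piecewise_density[OF assms(2) _ dens i] by simp
    have "density (\<mu> i) (\<lambda>x. ennreal (D x / q i)) = \<rho>' i"
    proof (rule measure_eqI)
      show "sets (density (\<mu> i) (\<lambda>x. ennreal (D x / q i))) = sets (\<rho>' i)"
        using sets[OF i] assms(4)[OF i] by simp
      fix B assume "B \<in> sets (density (\<mu> i) (\<lambda>x. ennreal (D x / q i)))"
      then have [measurable]: "B \<in> sets (\<mu> i)" by simp
      have "ennreal (D x / q i) = ennreal (1 / q i) * ennreal (D x)" for x
        using q D(2)[of x] by (simp flip: ennreal_mult')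
      then show "emeasure (density (\<mu> i) (\<lambda>x. ennreal (D x / q i))) B = emeasure (\<rho>' i) B"
        unfolding assms(4)[OF i] restr[symmetric]
        by (simp add: emeasure_density mult.assoc nn_integral_cmult)
    qed
    then have H: "generalized_entropy (\<mu> i) (\<rho>' i)
        = ereal_integral (\<mu> i) (\<lambda>x. - (D x / q i * ln (D x / q i)))"
      using q D(2) by (intro generalized_entropy_density[OF sf[OF i]]) auto
    \<comment> \<open>The total mass \<open>q i\<close> is finite, so the linear term
      \<open>- ln (q i) * D\<close> is integrable; its integral \<open>- (q i * ln (q i))\<close> is
      one summand of the Shannon entropy.\<close>
    have "(\<integral>\<^sup>+x. ennreal (D x) \<partial>\<mu> i) = emeasure (density (\<mu> i) (\<lambda>x. ennreal (D x))) (space (\<mu> i))"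
      by (simp add: emeasure_density cong: nn_integral_cong_simp)
    also have "\<dots> = ennreal (q i)"
      using restr E[OF i] sets_eq_imp_space_eq[OF sets[OF i]] assms(3)[OF i]
      by (simp add: emeasure_restricted_measure emeasure_eq_measure)
    finally have "(\<integral>\<^sup>+x. ennreal (D x) \<partial>\<mu> i) = ennreal (q i)" .
    then have int: "integrable (\<mu> i) D" "(\<integral>x. D x \<partial>\<mu> i) = q i"
      using nn_integral_eq_integrable[of D "\<mu> i" "q i"] D(2) q by auto
    have "ereal_integral (\<mu> i) (\<lambda>x. - (D x * ln (D x)))
        = ereal_integral (\<mu> i) (\<lambda>x. q i * - (D x / q i * ln (D x / q i)) + - ln (q i) * D x)"
      using entropy_integrand_rescale[OF q D(2)] by simp
    also have "\<dots> = ereal_integral (\<mu> i) (\<lambda>x. q i * - (D x / q i * ln (D x / q i)))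
        + ereal (\<integral>x. - ln (q i) * D x \<partial>\<mu> i)"
      using int by (intro ereal_integral_add_integrable) simp_all
    also have "\<dots> = ereal (q i) * generalized_entropy (\<mu> i) (\<rho>' i) + ereal (- (q i * ln (q i)))"
      using int ereal_integral_cmult[OF _ q, of "\<lambda>x. - (D x / q i * ln (D x / q i))" "\<mu> i"] H
      by (simp add: mult.commute)
    finally show ?thesis .
  qed
  have "generalized_entropy ?M \<rho> = ereal_integral ?M (\<lambda>x. - (D x * ln (D x)))"
    by (rule generalized_entropy_density[OF sfM D(1,2) dens])
  also have "\<dots> = (\<Sum>i=1..k. ereal_integral (\<mu> i) (\<lambda>x. - (D x * ln (D x))))"
    using sets by (intro ereal_integral_sum_of_measures) auto
  also have "\<dots> = (\<Sum>i=1..k. ereal (q i) * generalized_entropy (\<mu> i) (\<rho>' i))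
      + (\<Sum>i=1..k. ereal (- (q i * ln (q i))))"
    by (simp only: piece sum.distrib cong: sum.cong)
  also have "(\<Sum>i=1..k. ereal (- (q i * ln (q i)))) = ereal (shannon_entropy k q)"
    by (simp only: sum_ereal shannon_entropy_def sum_negf)
  finally show ?thesis by (simp add: add.commute)
qed

end
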